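(* Let $x=(x_1,x_2,\dots)\in l_1$ with $\|x\|\ge 1$. Then $$P_{\mathbb B}(x)=\Big\{y=(y_1,y_2,\dots)\in\mathbb B:\ \|y\|=1,\ \|x-y\|=\|x\|-1,\ \text{and for every } n\ge 1:\ 0\le y_n\le x_n\wedge 1 \text{ if } x_n\ge 0,\ \ x_n\vee(-1)\le y_n\le 0 \text{ if } x_n<0\Big\}.$$ In particular: (I) $\frac{x}{\|x\|}\in P_{\mathbb B}(x)$ for any $x\in l_1$ with $\|x\|\ge 1$. (II) If $x\in K$ with $\|x\|\ge 1$, then $$P_{\mathbb B}(x)=\Big\{y\in\mathbb B:\ \sum_{n=1}^\infty y_n=1,\ \|x-y\|=\|x\|-1,\ 0\le y_n\le x_n\wedge 1\ \text{for each } n\ge 1\Big\}.$$ (III) If $x\in -K$ with $\|x\|\ge 1$, then $$P_{\mathbb B}(x)=\Big\{y\in\mathbb B:\ \sum_{n=1}^\infty y_n=-1,\ \|x-y\|=\|x\|-1,\ x_n\vee(-1)\le y_n\le 0\ \text{for each } n\ge 1\Big\}.$$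
   Context: $(l_1,\|\cdot\|)$ is the real Banach space of absolutely summable real sequences $x=(x_1,x_2,\dots)$ with norm $\|x\|=\sum_{n=1}^\infty|x_n|$. $\mathbb B=\{x\in l_1:\|x\|\le 1\}$ is its closed unit ball. $K=\{x\in l_1: x_n\ge 0 \text{ for all } n\ge 1\}$ and $-K=\{-x:x\in K\}$. For real $a,b$: $a\wedge b=\min\{a,b\}$, $a\vee b=\max\{a,b\}$. The set-valued metric projection $P_{\mathbb B}:l_1\rightrightarrows\mathbb B$ is $P_{\mathbb B}(x)=\{u\in\mathbb B:\|x-u\|\le\|x-v\|\text{ for each } v\in\mathbb B\}$. *)

theory Defs
  imports "HOL-Analysis.Analysis"
begin

text \<open>Sequences are indexed from 0: \<open>l1_nth x n\<close> is the coordinate usually written \<open>x_{n+1}\<close>.\<close>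

typedef l1 = "{x :: nat \<Rightarrow> real. summable (\<lambda>n. \<bar>x n\<bar>)}"
  morphisms l1_nth Abs_l1
  by (rule exI[of _ "\<lambda>_. 0"]) simp

setup_lifting type_definition_l1

lemma summable_abs_l1_nth [simp]: "summable (\<lambda>n. \<bar>l1_nth x n\<bar>)"
  using l1_nth[of x] by simp

lemma summable_l1_nth [simp]: "summable (l1_nth x)"
  by (rule summable_rabs_cancel) simp

lemma l1_eqI: "(\<And>n. l1_nth x n = l1_nth y n) \<Longrightarrow> x = y"
  by (simp add: l1_nth_inject[symmetric] fun_eq_iff)

lemma summable_abs_add:
  fixes f g :: "nat \<Rightarrow> real"
  assumes "summable (\<lambda>n. \<bar>f n\<bar>)" "summable (\<lambda>n. \<bar>g n\<bar>)"
  shows "summable (\<lambda>n. \<bar>f n + g n\<bar>)"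
  by (rule summable_comparison_test'[OF summable_add[OF assms], of 0])
    (simp add: abs_triangle_ineq)

instantiation l1 :: real_vector
begin

lift_definition zero_l1 :: l1 is "\<lambda>_. 0" by simp

lift_definition uminus_l1 :: "l1 \<Rightarrow> l1" is "\<lambda>x n. - x n" by simp

lift_definition plus_l1 :: "l1 \<Rightarrow> l1 \<Rightarrow> l1" is "\<lambda>x y n. x n + y n"
  by (rule summable_abs_add)

lift_definition minus_l1 :: "l1 \<Rightarrow> l1 \<Rightarrow> l1" is "\<lambda>x y n. x n - y n"
  subgoal for f g
    using summable_abs_add[of f "\<lambda>n. - g n"] by simp
  done

lift_definition scaleR_l1 :: "real \<Rightarrow> l1 \<Rightarrow> l1" is "\<lambda>c x n. c * x n"
  by (simp add: abs_mult summable_mult)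

instance
  by standard (transfer; simp add: algebra_simps fun_eq_iff)+

end

lemma l1_nth_simps [simp]:
  "l1_nth 0 n = 0"
  "l1_nth (- x) n = - l1_nth x n"
  "l1_nth (x + y) n = l1_nth x n + l1_nth y n"
  "l1_nth (x - y) n = l1_nth x n - l1_nth y n"
  "l1_nth (c *\<^sub>R x) n = c * l1_nth x n"
  by (transfer; simp)+

instantiation l1 :: real_normed_vector
begin

definition norm_l1 :: "l1 \<Rightarrow> real"
  where "norm_l1 x = (\<Sum>n. \<bar>l1_nth x n\<bar>)"

definition dist_l1 :: "l1 \<Rightarrow> l1 \<Rightarrow> real"
  where "dist_l1 x y = norm (x - y)"

definition sgn_l1 :: "l1 \<Rightarrow> l1"
  where "sgn_l1 x = x /\<^sub>R norm x"

definition uniformity_l1 :: "(l1 \<times> l1) filter"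
  where "uniformity_l1 = (INF e\<in>{0 <..}. principal {(x, y). dist x y < e})"

definition open_l1 :: "l1 set \<Rightarrow> bool"
  where "open_l1 U = (\<forall>x\<in>U. \<forall>\<^sub>F (x', y) in uniformity. x' = x \<longrightarrow> y \<in> U)"

instance
proof
  fix x y :: l1 and c :: real
  show "norm x = 0 \<longleftrightarrow> x = 0"
    by (auto simp: norm_l1_def suminf_eq_zero_iff intro: l1_eqI)
  have "norm (x + y) \<le> (\<Sum>n. \<bar>l1_nth x n\<bar> + \<bar>l1_nth y n\<bar>)"
    unfolding norm_l1_def
    by (intro suminf_le summable_add summable_abs_l1_nth) (simp add: abs_triangle_ineq)
  also have "\<dots> = norm x + norm y"
    by (simp add: norm_l1_def suminf_add)
  finally show "norm (x + y) \<le> norm x + norm y" .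
  show "norm (c *\<^sub>R x) = \<bar>c\<bar> * norm x"
    by (simp add: norm_l1_def abs_mult suminf_mult)
qed (rule dist_l1_def sgn_l1_def uniformity_l1_def open_l1_def)+

end

lemma sum_abs_le_norm_l1: "(\<Sum>n<k. \<bar>l1_nth x n\<bar>) \<le> norm x"
  unfolding norm_l1_def by (rule sum_le_suminf) auto

lemma abs_l1_nth_le_norm: "\<bar>l1_nth x n\<bar> \<le> norm x"
proof -
  have "\<bar>l1_nth x n\<bar> \<le> (\<Sum>i<Suc n. \<bar>l1_nth x i\<bar>)"
    by (simp add: sum_nonneg)
  also have "\<dots> \<le> norm x"
    by (rule sum_abs_le_norm_l1)
  finally show ?thesis .
qed

instance l1 :: banach
proof
  fix X :: "nat \<Rightarrow> l1"
  assume X: "Cauchy X"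
  have "Cauchy (\<lambda>m. l1_nth (X m) n)" for n
  proof (rule CauchyI)
    fix e :: real
    assume "e > 0"
    then obtain M where "\<forall>i\<ge>M. \<forall>j\<ge>M. norm (X i - X j) < e"
      using CauchyD[OF X] by blast
    then show "\<exists>M. \<forall>i\<ge>M. \<forall>j\<ge>M. norm (l1_nth (X i) n - l1_nth (X j) n) < e"
      by (metis abs_l1_nth_le_norm l1_nth_simps(4) le_less_trans real_norm_def)
  qed
  then have "\<forall>n. \<exists>l. (\<lambda>m. l1_nth (X m) n) \<longlonglongrightarrow> l"
    by (simp add: Cauchy_convergent_iff convergent_def)
  then obtain f where f: "\<And>n. (\<lambda>m. l1_nth (X m) n) \<longlonglongrightarrow> f n"
    by metis
  have partial: "\<exists>M. \<forall>i\<ge>M. \<forall>k. (\<Sum>n<k. \<bar>l1_nth (X i) n - f n\<bar>) \<le> e" if "e > 0" for e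
  proof -
    obtain M where M: "\<forall>i\<ge>M. \<forall>j\<ge>M. norm (X i - X j) < e"
      using CauchyD[OF X \<open>e > 0\<close>] by blast
    have "(\<Sum>n<k. \<bar>l1_nth (X i) n - f n\<bar>) \<le> e" if "i \<ge> M" for i k
    proof (rule LIMSEQ_le_const2)
      show "(\<lambda>j. \<Sum>n<k. \<bar>l1_nth (X i) n - l1_nth (X j) n\<bar>)
          \<longlonglongrightarrow> (\<Sum>n<k. \<bar>l1_nth (X i) n - f n\<bar>)"
        by (intro tendsto_intros f)
      have "(\<Sum>n<k. \<bar>l1_nth (X i) n - l1_nth (X j) n\<bar>) \<le> e" if "j \<ge> M" for j
        using sum_abs_le_norm_l1[where x = "X i - X j" and k = k] M \<open>i \<ge> M\<close> that
        by (fastforce intro: order.trans less_imp_le)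
      then show "\<exists>N. \<forall>j\<ge>N. (\<Sum>n<k. \<bar>l1_nth (X i) n - l1_nth (X j) n\<bar>) \<le> e"
        by blast
    qed
    then show ?thesis by blast
  qed
  obtain M where "\<And>k. (\<Sum>n<k. \<bar>l1_nth (X M) n - f n\<bar>) \<le> 1"
    using partial[of 1] by auto
  then have diff: "summable (\<lambda>n. \<bar>l1_nth (X M) n - f n\<bar>)"
    by (intro summableI_nonneg_bounded[where x = 1]) auto
  have "summable (\<lambda>n. \<bar>f n\<bar>)"
    using summable_abs_add[of "\<lambda>n. f n - l1_nth (X M) n" "l1_nth (X M)"] diff
    by (simp add: abs_minus_commute)
  then have L: "l1_nth (Abs_l1 f) = f"
    by (simp add: Abs_l1_inverse)
  have "X \<longlonglongrightarrow> Abs_l1 f"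
  proof (rule LIMSEQ_I)
    fix e :: real
    assume "e > 0"
    then obtain M where M: "\<And>i k. i \<ge> M \<Longrightarrow> (\<Sum>n<k. \<bar>l1_nth (X i) n - f n\<bar>) \<le> e / 2"
      using partial[of "e / 2"] by auto
    have "norm (X i - Abs_l1 f) < e" if "i \<ge> M" for i
    proof -
      have "norm (X i - Abs_l1 f) \<le> e / 2"
        unfolding norm_l1_def
        by (rule suminf_le_const[OF summable_abs_l1_nth]) (use M[OF that] in \<open>simp add: L\<close>)
      then show ?thesis using \<open>e > 0\<close> by simp
    qed
    then show "\<exists>M. \<forall>i\<ge>M. norm (X i - Abs_l1 f) < e" by blast
  qed
  then show "convergent X" by (rule convergentI)
qed

definition l1_cone :: "l1 set"
  where "l1_cone = {x. \<forall>n. 0 \<le> l1_nth x n}"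

definition metric_projection :: "'a::real_normed_vector set \<Rightarrow> 'a \<Rightarrow> 'a set"
  where "metric_projection C x = {u \<in> C. \<forall>v\<in>C. norm (x - u) \<le> norm (x - v)}"

abbreviation l1_ball :: "l1 set"
  where "l1_ball \<equiv> cball 0 1"

end

theory Submission
  imports Defs
begin

text \<open>The distance from \<open>x\<close> to the unit ball is \<open>norm x - 1\<close>, attained at \<open>x / norm x\<close>. For a
  nearest point \<open>y\<close> the triangle inequality \<open>norm x \<le> norm (x - y) + norm y\<close> is therefore an equality.
  In \<open>l\<^sub>1\<close> this equality holds coordinatewise, which says exactly that each \<open>y\<^sub>n\<close> lies between 0
  and \<open>x\<^sub>n\<close>.\<close>

lemma norm_diff_normalized:
  fixes x :: "'a::real_normed_vector"
  assumes "norm x \<ge> 1"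
  shows "norm (x - x /\<^sub>R norm x) = norm x - 1"
proof -
  have "x \<noteq> 0"
    using assms by auto
  have "x - x /\<^sub>R norm x = (1 - inverse (norm x)) *\<^sub>R x"
    by (simp add: scaleR_diff_left)
  moreover have "inverse (norm x) \<le> 1"
    using assms by (simp add: inverse_le_1_iff)
  ultimately have "norm (x - x /\<^sub>R norm x) = (1 - inverse (norm x)) * norm x"
    by simp
  also have "\<dots> = norm x - 1"
    using \<open>x \<noteq> 0\<close> by (simp add: left_diff_distrib)
  finally show ?thesis .
qed

lemma normalized_in_unit_ball:
  fixes x :: "'a::real_normed_vector"
  shows "x /\<^sub>R norm x \<in> cball 0 1"
  \<comment> \<open>For \<open>x = 0\<close> the convention \<open>inverse 0 = 0\<close> gives the
    point 0; otherwise the norm is 1.\<close>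
  by (cases "x = 0") auto

text \<open>No coordinates are involved: the reverse triangle inequality bounds the distance below
  by \<open>norm x - 1\<close> in any normed space, and the normalized point attains the
  bound.\<close>

lemma metric_projection_unit_ball:
  fixes x :: "'a::real_normed_vector"
  assumes "norm x \<ge> 1"
  shows "metric_projection (cball 0 1) x = {y \<in> cball 0 1. norm (x - y) = norm x - 1}"
proof -
  have lower: "norm x - 1 \<le> norm (x - v)" if "v \<in> cball 0 1" for v
    using norm_triangle_ineq2[of x v] that by simp
  have "norm (x - y) = norm x - 1"
    if "y \<in> cball 0 1" "\<forall>v\<in>cball 0 1. norm (x - y) \<le> norm (x - v)" for y
    using bspec[OF that(2) normalized_in_unit_ball[of x]] norm_diff_normalized[OF assms]
      lower[OF that(1)] by linarith
  moreover have "\<forall>v\<in>cball 0 1. norm (x - y) \<le> norm (x - v)" if "norm (x - y) = norm x - 1" for y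
    unfolding that using lower by (rule ballI)
  ultimately show ?thesis
    unfolding metric_projection_def by blast
qed

text \<open>The coordinatewise defects \<open>?g\<close> of the triangle inequality are nonnegative,
  and their series sums to \<open>norm (x - y) + norm y - norm x = 0\<close>. Hence every defect
  vanishes.\<close>

lemma l1_norm_triangle_eqD:
  assumes "norm x = norm (x - y) + norm (y :: l1)"
  shows "\<bar>l1_nth x n\<bar> = \<bar>l1_nth x n - l1_nth y n\<bar> + \<bar>l1_nth y n\<bar>"
proof -
  let ?g = "\<lambda>n. \<bar>l1_nth (x - y) n\<bar> + \<bar>l1_nth y n\<bar> - \<bar>l1_nth x n\<bar>"
  have sums: "summable (\<lambda>n. \<bar>l1_nth (x - y) n\<bar> + \<bar>l1_nth y n\<bar>)"
    by (intro summable_add summable_abs_l1_nth)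
  have "suminf ?g = norm (x - y) + norm y - norm x"
    unfolding norm_l1_def
    by (simp only: suminf_add suminf_diff[OF sums] summable_abs_l1_nth)
  moreover have "summable ?g"
    by (intro summable_diff sums summable_abs_l1_nth)
  moreover have "0 \<le> ?g n" for n
    by simp
  ultimately have "?g n = 0"
    using assms suminf_eq_zero_iff[of ?g] by simp
  then show ?thesis by simp
qed

lemma norm_l1_eq_suminf:
  assumes "\<And>n. 0 \<le> l1_nth y n"
  shows "norm y = (\<Sum>n. l1_nth y n)"
  using assms by (simp add: norm_l1_def)

lemma metric_projection_l1_ball:
  assumes "norm x \<ge> 1"
  shows "metric_projection l1_ball x =
    {y \<in> l1_ball. norm y = 1 \<and> norm (x - y) = norm x - 1 \<and>
      (\<forall>n. (l1_nth x n \<ge> 0 \<longrightarrow> 0 \<le> l1_nth y n \<and> l1_nth y n \<le> min (l1_nth x n) 1) \<and>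
           (l1_nth x n < 0 \<longrightarrow> max (l1_nth x n) (-1) \<le> l1_nth y n \<and> l1_nth y n \<le> 0))}"
    (is "_ = ?R")
proof -
  have "y \<in> ?R" if y: "y \<in> l1_ball" and d: "norm (x - y) = norm x - 1" for y
  proof -
    \<comment> \<open>The triangle inequality gives
      \<open>norm x - norm (x - y) \<le> norm y\<close>, so \<open>norm y\<close> is at least 1;
      membership in the ball gives the other bound.\<close>
    have "norm y = 1"
      using norm_triangle_ineq2[of x "x - y"] y d by simp
    then have "norm x = norm (x - y) + norm y"
      using d by simp
    then have split: "\<bar>l1_nth x n\<bar> = \<bar>l1_nth x n - l1_nth y n\<bar> + \<bar>l1_nth y n\<bar>" for n
      by (rule l1_norm_triangle_eqD)
    have bound: "\<bar>l1_nth y n\<bar> \<le> 1" for n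
      using abs_l1_nth_le_norm[of y n] \<open>norm y = 1\<close> by simp
    \<comment> \<open>For reals, \<open>\<bar>a\<bar> = \<bar>a - b\<bar> + \<bar>b\<bar>\<close>
      forces \<open>b\<close> to lie between 0 and \<open>a\<close>; the cutoff at 1 or -1 comes
      from \<open>bound\<close>.\<close>
    have "0 \<le> l1_nth y n \<and> l1_nth y n \<le> min (l1_nth x n) 1" if "l1_nth x n \<ge> 0" for n
      using split[of n] bound[of n] that by linarith
    moreover have "max (l1_nth x n) (-1) \<le> l1_nth y n \<and> l1_nth y n \<le> 0" if "l1_nth x n < 0" for n
      using split[of n] bound[of n] that by linarith
    ultimately show ?thesis
      using y d \<open>norm y = 1\<close> by blast
  qed
  then show ?thesis
    unfolding metric_projection_unit_ball[OF assms] by blast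
qed

text \<open>On the cone the negative case of the sign conditions is vacuous, and the bounds make
  \<open>y\<close> nonnegative, so its norm is its plain sum.\<close>

lemma metric_projection_l1_ball_cone:
  assumes "x \<in> l1_cone" "norm x \<ge> 1"
  shows "metric_projection l1_ball x =
    {y \<in> l1_ball. (\<Sum>n. l1_nth y n) = 1 \<and> norm (x - y) = norm x - 1 \<and>
      (\<forall>n. 0 \<le> l1_nth y n \<and> l1_nth y n \<le> min (l1_nth x n) 1)}"
proof -
  have x: "l1_nth x n \<ge> 0" for n
    using assms(1) by (simp add: l1_cone_def)
  have signs: "(l1_nth x n \<ge> 0 \<longrightarrow> 0 \<le> l1_nth y n \<and> l1_nth y n \<le> min (l1_nth x n) 1) \<and>
      (l1_nth x n < 0 \<longrightarrow> max (l1_nth x n) (-1) \<le> l1_nth y n \<and> l1_nth y n \<le> 0) \<longleftrightarrow>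
      0 \<le> l1_nth y n \<and> l1_nth y n \<le> min (l1_nth x n) 1" for y n
    using x[of n] by auto
  have norm_iff: "norm y = 1 \<longleftrightarrow> (\<Sum>n. l1_nth y n) = 1" if "\<And>n. 0 \<le> l1_nth y n" for y
    using norm_l1_eq_suminf[OF that] by simp
  show ?thesis
    unfolding metric_projection_l1_ball[OF assms(2)] signs
  proof (intro Collect_cong)
    fix y
    show "y \<in> l1_ball \<and> norm y = 1 \<and> norm (x - y) = norm x - 1 \<and>
          (\<forall>n. 0 \<le> l1_nth y n \<and> l1_nth y n \<le> min (l1_nth x n) 1) \<longleftrightarrow>
        y \<in> l1_ball \<and> (\<Sum>n. l1_nth y n) = 1 \<and> norm (x - y) = norm x - 1 \<and>
          (\<forall>n. 0 \<le> l1_nth y n \<and> l1_nth y n \<le> min (l1_nth x n) 1)"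
    \<comment> \<open>\<open>norm_iff\<close> covers nonnegative \<open>y\<close>; for any other
      \<open>y\<close> the coordinate bounds fail on both sides.\<close>
    proof (cases "\<forall>n. 0 \<le> l1_nth y n")
      case True
      then show ?thesis
        by (simp add: norm_iff)
    qed blast
  qed
qed

lemma metric_projection_l1_ball_uminus_cone:
  assumes "x \<in> uminus ` l1_cone" "norm x \<ge> 1"
  shows "metric_projection l1_ball x =
    {y \<in> l1_ball. (\<Sum>n. l1_nth y n) = -1 \<and> norm (x - y) = norm x - 1 \<and>
      (\<forall>n. max (l1_nth x n) (-1) \<le> l1_nth y n \<and> l1_nth y n \<le> 0)}"
proof -
  have x: "l1_nth x n \<le> 0" for n
    using assms(1) by (auto simp: l1_cone_def)
  have signs: "(l1_nth x n \<ge> 0 \<longrightarrow> 0 \<le> l1_nth y n \<and> l1_nth y n \<le> min (l1_nth x n) 1) \<and>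
      (l1_nth x n < 0 \<longrightarrow> max (l1_nth x n) (-1) \<le> l1_nth y n \<and> l1_nth y n \<le> 0) \<longleftrightarrow>
      max (l1_nth x n) (-1) \<le> l1_nth y n \<and> l1_nth y n \<le> 0" for y n
    \<comment> \<open>A zero coordinate of \<open>x\<close> falls under the nonnegative case, but
      there both pairs of bounds say \<open>l1_nth y n = 0\<close>.\<close>
    using x[of n] by (cases "l1_nth x n = 0") auto
  have norm_iff: "norm y = 1 \<longleftrightarrow> (\<Sum>n. l1_nth y n) = -1" if "\<And>n. l1_nth y n \<le> 0" for y
    \<comment> \<open>Negation preserves the norm and makes the coordinates nonnegative, so
      \<open>norm y\<close> is minus the sum of \<open>y\<close>.\<close>
    using norm_l1_eq_suminf[of "- y"] that by (simp add: suminf_minus)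
  show ?thesis
    unfolding metric_projection_l1_ball[OF assms(2)] signs
  proof (intro Collect_cong)
    fix y
    show "y \<in> l1_ball \<and> norm y = 1 \<and> norm (x - y) = norm x - 1 \<and>
          (\<forall>n. max (l1_nth x n) (-1) \<le> l1_nth y n \<and> l1_nth y n \<le> 0) \<longleftrightarrow>
        y \<in> l1_ball \<and> (\<Sum>n. l1_nth y n) = -1 \<and> norm (x - y) = norm x - 1 \<and>
          (\<forall>n. max (l1_nth x n) (-1) \<le> l1_nth y n \<and> l1_nth y n \<le> 0)"
    proof (cases "\<forall>n. l1_nth y n \<le> 0")
      case True
      then show ?thesis
        by (simp add: norm_iff)
    qed blast
  qed
qed

theorem theorem3p1:
  shows
    "(\<forall>x::l1. norm x \<ge> 1 \<longrightarrow>
        metric_projection l1_ball x =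
          {y \<in> l1_ball. norm y = 1 \<and> norm (x - y) = norm x - 1 \<and>
            (\<forall>n. (l1_nth x n \<ge> 0 \<longrightarrow> 0 \<le> l1_nth y n \<and> l1_nth y n \<le> min (l1_nth x n) 1) \<and>
                 (l1_nth x n < 0 \<longrightarrow> max (l1_nth x n) (-1) \<le> l1_nth y n \<and> l1_nth y n \<le> 0))}) \<and>
     (\<forall>x::l1. norm x \<ge> 1 \<longrightarrow> x /\<^sub>R norm x \<in> metric_projection l1_ball x) \<and>
     (\<forall>x \<in> l1_cone. norm x \<ge> 1 \<longrightarrow>
        metric_projection l1_ball x =
          {y \<in> l1_ball. (\<Sum>n. l1_nth y n) = 1 \<and> norm (x - y) = norm x - 1 \<and>
            (\<forall>n. 0 \<le> l1_nth y n \<and> l1_nth y n \<le> min (l1_nth x n) 1)}) \<and>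
     (\<forall>x \<in> uminus ` l1_cone. norm x \<ge> 1 \<longrightarrow>
        metric_projection l1_ball x =
          {y \<in> l1_ball. (\<Sum>n. l1_nth y n) = -1 \<and> norm (x - y) = norm x - 1 \<and>
            (\<forall>n. max (l1_nth x n) (-1) \<le> l1_nth y n \<and> l1_nth y n \<le> 0)})"
proof (intro conjI allI ballI impI)
  fix x :: l1
  assume x: "norm x \<ge> 1"
  \<comment> \<open>The description by distance alone suffices here, so no coordinate bounds have to
    be checked.\<close>
  show "x /\<^sub>R norm x \<in> metric_projection l1_ball x"
    unfolding metric_projection_unit_ball[OF x]
    using normalized_in_unit_ball norm_diff_normalized[OF x] by blast
qed (rule metric_projection_l1_ball metric_projection_l1_ball_cone
    metric_projection_l1_ball_uminus_cone; assumption)+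

end
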